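(* Let $\mathcal{K}$ be a field, let $r\ge 5$ and $k\ge 1$ be integers, and let $$\mathcal{R}=\mathcal{K}[s^{2r+1},\ s^{r+1}t^{r},\ s^{3}t^{2r-2},\ s^{2}t^{2r-1},\ t^{2r+1}]\subseteq\mathcal{K}[s,t].$$ Then $\mathcal{R}$ is strictly $k$-Buchsbaum if and only if $r\in\{2+3k,\ 3+3k,\ 4+3k\}$.
   Context: Let $\mathfrak{m}$ be the homogeneous maximal ideal of $\mathcal{R}$, generated by the five listed monomials. For $k\ge 1$, $\mathcal{R}$ is $k$-Buchsbaum if $\mathfrak{m}^kH^1_{\mathfrak{m}}(\mathcal{R})=0$ (local cohomology), and strictly $k$-Buchsbaum if $k$ is the least integer with this property, i.e. $\mathfrak{m}^kH^1_{\mathfrak{m}}(\mathcal{R})=0$ but $\mathfrak{m}^{k-1}H^1_{\mathfrak{m}}(\mathcal{R})\neq 0$ (where $\mathfrak{m}^0=\mathcal{R}$). *)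

theory Defs
  imports
    "HOL-Algebra.Module"
    "HOL-Algebra.Ideal_Product"
    "HOL-Algebra.Generated_Rings"
    "HOL-Algebra.Algebraic_Closure_Type"
    "HOL-Computational_Algebra.Polynomial"
begin

section \<open>Modules and injective resolutions\<close>

definition mod_homs ::
    "('r, 'm) ring_scheme \<Rightarrow> ('r, 'a) module \<Rightarrow> ('r, 'b) module \<Rightarrow> ('a \<Rightarrow> 'b) set" where
  "mod_homs R M N = {f \<in> carrier M \<rightarrow> carrier N.
     (\<forall>x\<in>carrier M. \<forall>y\<in>carrier M. f (x \<oplus>\<^bsub>M\<^esub> y) = f x \<oplus>\<^bsub>N\<^esub> f y) \<and>
     (\<forall>a\<in>carrier R. \<forall>x\<in>carrier M. f (a \<odot>\<^bsub>M\<^esub> x) = a \<odot>\<^bsub>N\<^esub> f x)}"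

text \<open>
  A definition cannot quantify over types, so the extension property is required for monomorphisms
  between modules whose elements are drawn from the element type of \<open>R\<close>. These include
  the inclusions of ideals into \<open>R\<close>, so by Baer's criterion nothing is lost.
\<close>
definition injective_module :: "('r, 'm) ring_scheme \<Rightarrow> ('r, 'e) module \<Rightarrow> bool" where
  "injective_module R E \<longleftrightarrow> module R E \<and>
     (\<forall>(A :: ('r, 'r) module) (B :: ('r, 'r) module) i f.
        module R A \<and> module R B \<and> i \<in> mod_homs R A B \<and> inj_on i (carrier A) \<and>
        f \<in> mod_homs R A E \<longrightarrow>
        (\<exists>g \<in> mod_homs R B E. \<forall>x\<in>carrier A. g (i x) = f x))"

text \<open>\<open>0 \<rightarrow> M \<rightarrow> I 0 \<rightarrow> I 1 \<rightarrow> \<dots>\<close> is exact, with augmentation \<open>e\<close>, differentials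
  \<open>d n : I n \<rightarrow> I (n + 1)\<close> and all \<open>I n\<close> injective.\<close>
definition injective_resolution ::
    "('r, 'm) ring_scheme \<Rightarrow> ('r, 'a) module \<Rightarrow> ('a \<Rightarrow> 'b) \<Rightarrow>
     (nat \<Rightarrow> ('r, 'b) module) \<Rightarrow> (nat \<Rightarrow> 'b \<Rightarrow> 'b) \<Rightarrow> bool" where
  "injective_resolution R M e I d \<longleftrightarrow>
     module R M \<and>
     (\<forall>n. injective_module R (I n)) \<and>
     e \<in> mod_homs R M (I 0) \<and> inj_on e (carrier M) \<and>
     (\<forall>n. d n \<in> mod_homs R (I n) (I (Suc n))) \<and>
     {x \<in> carrier (I 0). d 0 x = \<zero>\<^bsub>I 1\<^esub>} = e ` carrier M \<and>
     (\<forall>n. {x \<in> carrier (I (Suc n)). d (Suc n) x = \<zero>\<^bsub>I (Suc (Suc n))\<^esub>} = d n ` carrier (I n))"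

definition regular_module :: "('r, 'm) ring_scheme \<Rightarrow> ('r, 'r) module" where
  "regular_module R =
     \<lparr>carrier = carrier R, monoid.mult = monoid.mult R, one = \<one>\<^bsub>R\<^esub>,
      zero = \<zero>\<^bsub>R\<^esub>, add = add R, module.smult = monoid.mult R\<rparr>"

text \<open>The fields \<open>mult\<close> and \<open>one\<close> of a module record play no role.\<close>
definition quotient_module :: "('r, 'b) module \<Rightarrow> 'b set \<Rightarrow> ('r, 'b set) module" where
  "quotient_module N U =
     \<lparr>carrier = a_rcosets\<^bsub>N\<^esub> U, monoid.mult = undefined, one = undefined,
      zero = U, add = set_add N,
      module.smult = (\<lambda>a C. \<Union>x\<in>C. U +>\<^bsub>N\<^esub> (a \<odot>\<^bsub>N\<^esub> x))\<rparr>"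

section \<open>Local cohomology\<close>

definition ideal_power :: "('r, 'm) ring_scheme \<Rightarrow> 'r set \<Rightarrow> nat \<Rightarrow> 'r set" where
  "ideal_power R J n = J [^]\<^bsub>ideals_set R\<^esub> n"

definition torsion_part :: "('r, 'm) ring_scheme \<Rightarrow> 'r set \<Rightarrow> ('r, 'b) module \<Rightarrow> 'b set" where
  "torsion_part R J M =
     {x \<in> carrier M. \<exists>n. \<forall>a \<in> ideal_power R J n. a \<odot>\<^bsub>M\<^esub> x = \<zero>\<^bsub>M\<^esub>}"

definition torsion_cocycles ::
    "('r, 'm) ring_scheme \<Rightarrow> 'r set \<Rightarrow> (nat \<Rightarrow> ('r, 'b) module) \<Rightarrow> (nat \<Rightarrow> 'b \<Rightarrow> 'b) \<Rightarrow>
     nat \<Rightarrow> 'b set" where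
  "torsion_cocycles R J I d i = {x \<in> torsion_part R J (I i). d i x = \<zero>\<^bsub>I (Suc i)\<^esub>}"

definition torsion_coboundaries ::
    "('r, 'm) ring_scheme \<Rightarrow> 'r set \<Rightarrow> (nat \<Rightarrow> ('r, 'b) module) \<Rightarrow> (nat \<Rightarrow> 'b \<Rightarrow> 'b) \<Rightarrow>
     nat \<Rightarrow> 'b set" where
  "torsion_coboundaries R J I d i =
     (case i of 0 \<Rightarrow> {\<zero>\<^bsub>I 0\<^esub>} | Suc j \<Rightarrow> d j ` torsion_part R J (I j))"

text \<open>
  The \<open>i\<close>-th right derived functor of the \<open>J\<close>-torsion functor at \<open>M\<close>, computed from an injective
  resolution \<open>(I, d)\<close> of \<open>M\<close>: the \<open>i\<close>-th cohomology of the complex of \<open>J\<close>-torsion parts of \<open>I\<close>.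
  Up to isomorphism it does not depend on the resolution.
\<close>
definition local_cohomology ::
    "('r, 'm) ring_scheme \<Rightarrow> 'r set \<Rightarrow> (nat \<Rightarrow> ('r, 'b) module) \<Rightarrow> (nat \<Rightarrow> 'b \<Rightarrow> 'b) \<Rightarrow>
     nat \<Rightarrow> ('r, 'b set) module" where
  "local_cohomology R J I d i =
     quotient_module ((I i)\<lparr>carrier := torsion_cocycles R J I d i\<rparr>) (torsion_coboundaries R J I d i)"

definition annihilates :: "'r set \<Rightarrow> ('r, 'b) module \<Rightarrow> bool" where
  "annihilates J M \<longleftrightarrow> (\<forall>a\<in>J. \<forall>x\<in>carrier M. a \<odot>\<^bsub>M\<^esub> x = \<zero>\<^bsub>M\<^esub>)"

text \<open>Here \<open>(I, d)\<close> is an injective resolution of \<open>R\<close> as a module over itself, and \<open>k \<ge> 1\<close>.\<close>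
definition k_Buchsbaum ::
    "('r, 'm) ring_scheme \<Rightarrow> 'r set \<Rightarrow> (nat \<Rightarrow> ('r, 'b) module) \<Rightarrow> (nat \<Rightarrow> 'b \<Rightarrow> 'b) \<Rightarrow>
     nat \<Rightarrow> bool" where
  "k_Buchsbaum R J I d k \<longleftrightarrow> annihilates (ideal_power R J k) (local_cohomology R J I d 1)"

definition strictly_k_Buchsbaum ::
    "('r, 'm) ring_scheme \<Rightarrow> 'r set \<Rightarrow> (nat \<Rightarrow> ('r, 'b) module) \<Rightarrow> (nat \<Rightarrow> 'b \<Rightarrow> 'b) \<Rightarrow>
     nat \<Rightarrow> bool" where
  "strictly_k_Buchsbaum R J I d k \<longleftrightarrow>
     k_Buchsbaum R J I d k \<and>
     \<not> annihilates (ideal_power R J (k - 1)) (local_cohomology R J I d 1)"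

section \<open>The monomial subalgebra\<close>

text \<open>\<open>K[s,t]\<close> is \<open>K[t][s]\<close>, the type \<open>'a poly poly\<close>: the outer variable is \<open>s\<close>.\<close>
definition var_s :: "'a::field poly poly" where
  "var_s = [:0, 1:]"

definition var_t :: "'a::field poly poly" where
  "var_t = [:[:0, 1:]:]"

definition curve_monomials :: "nat \<Rightarrow> 'a::field poly poly set" where
  "curve_monomials r =
     {var_s ^ (2 * r + 1),
      var_s ^ (r + 1) * var_t ^ r,
      var_s ^ 3 * var_t ^ (2 * r - 2),
      var_s ^ 2 * var_t ^ (2 * r - 1),
      var_t ^ (2 * r + 1)}"

definition curve_ring :: "nat \<Rightarrow> 'a::field poly poly ring" where
  "curve_ring r = (ring_of_type_algebra :: 'a poly poly ring)
     \<lparr>carrier := generate_ring ring_of_type_algebra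
        (range (\<lambda>c. [:[:c:]:]) \<union> curve_monomials r)\<rparr>"

definition curve_max_ideal :: "nat \<Rightarrow> 'a::field poly poly set" where
  "curve_max_ideal r = genideal (curve_ring r) (curve_monomials r)"

end

theory Submission
  imports Defs
begin

text \<open>
  Let \<open>S\<close> be the semigroup of exponents of the monomials in the algebra \<open>R\<close>, and put \<open>D = 2r + 1\<close>.
  The maximal ideal contains \<open>s\<^sup>D\<close> and \<open>t\<^sup>D\<close>, whose powers are coprime in \<open>K[s,t]\<close>, so \<open>H\<^sup>1\<close> is the
  quotient by \<open>R\<close> of the module of polynomials that some power of the maximal ideal multiplies into \<open>R\<close>.
  The theorem \<open>annihilates_local_cohomology_1_iff\<close> derives this description, in the form needed for
  annihilators, directly from an injective resolution. The quotient has a basis of monomials, indexed by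
  the gaps: the pairs outside \<open>S\<close> that enter \<open>S\<close> after adding a multiple of \<open>(D, 0)\<close> and also after
  adding a multiple of \<open>(0, D)\<close>.

  The gaps form a single finite column \<open>(r + 2, 3r + D m)\<close> with \<open>3 m + 5 \<le> r\<close>
  (\<open>saturation_gaps\<close>, \<open>gap_in_exponents_iff\<close>). The reason is that in degree \<open>N\<close>, counted in
  generators, \<open>s\<^sup>3 t\<^bsup>2r-2\<^esup>\<close> and \<open>s\<^sup>2 t\<^bsup>2r-1\<^esup>\<close> reach all exponents of \<open>s\<close> up to \<open>3 N\<close> except
  \<open>1\<close>, while \<open>s\<^bsup>r+1\<^esup>t\<^sup>r\<close> is a shortcut to the exponents above \<open>r\<close> that misses only
  \<open>r + 2 = (r + 1) + 1\<close>. In that column the elements of \<open>S\<close> start in degree about \<open>r / 3\<close>. The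
  exponents of \<open>t\<close> alone do not show this: three shortcuts give the pair \<open>(3 (r + 1), 3 r)\<close>, which is
  \<open>(r + 2, 3 r) + (D, 0)\<close>, so the column of the saturation starts in degree \<open>2\<close>.

  Multiplication by \<open>t\<^sup>D\<close> moves every gap one place up in the column, and every other generator
  moves it out of the column and hence into \<open>S\<close>. So \<open>H\<^sup>1\<close> is the module \<open>K[t\<^sup>D] / (t\<^bsup>Dq\<^esup>)\<close>, where
  \<open>q = (r - 2) div 3\<close> is the number of gaps, and the \<open>k\<close>-th power of the maximal ideal kills it exactly
  for \<open>k \<ge> q\<close>. Being strictly \<open>k\<close>-Buchsbaum means \<open>k = q\<close>.
\<close>

section \<open>First local cohomology of a subring of a domain\<close>

text \<open>
  A class of the quotient is the coset \<open>U +> x\<close>, and multiplication by \<open>a\<close> sends it to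
  \<open>U +> (a \<odot> x)\<close>, so it becomes zero exactly when \<open>a \<odot> x\<close> falls into \<open>U\<close>. The numerator \<open>Z\<close> may be
  any subset: the coset operations are those of the whole module.
\<close>
lemma annihilates_quotient_module_iff:
  fixes M :: "('r, 'b) module"
  assumes M: "module R M"
    and U: "submodule U R M" and Z: "Z \<subseteq> carrier M" and W: "W \<subseteq> carrier R"
  shows "annihilates W (quotient_module (M\<lparr>carrier := Z\<rparr>) U) \<longleftrightarrow>
         (\<forall>a\<in>W. \<forall>x\<in>Z. a \<odot>\<^bsub>M\<^esub> x \<in> U)"
proof -
  interpret module R M by fact
  interpret U: submodule U R M by fact
  have UM: "U \<subseteq> carrier M" and sg: "subgroup U (add_monoid M)"
    using submoduleE(1)[OF U] U.subgroup_axioms by auto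
  have coset: "(\<Union>y\<in>U +>\<^bsub>M\<^esub> x. U +>\<^bsub>M\<^esub> (a \<odot>\<^bsub>M\<^esub> y)) = U \<longleftrightarrow> a \<odot>\<^bsub>M\<^esub> x \<in> U"
    if a: "a \<in> carrier R" and x: "x \<in> carrier M" for a x
  proof -
    have "U +>\<^bsub>M\<^esub> (a \<odot>\<^bsub>M\<^esub> (u \<oplus>\<^bsub>M\<^esub> x)) = U +>\<^bsub>M\<^esub> (a \<odot>\<^bsub>M\<^esub> x)" if u: "u \<in> U" for u
    proof -
      have "u \<in> carrier M" "a \<odot>\<^bsub>M\<^esub> u \<in> U" using u UM a by auto
      moreover have "a \<odot>\<^bsub>M\<^esub> u \<in> carrier M" using \<open>a \<odot>\<^bsub>M\<^esub> u \<in> U\<close> UM by auto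
      ultimately show ?thesis
        using a x UM sg
        by (simp add: smult_r_distr M.a_coset_add_assoc[symmetric] M.a_coset_join2)
    qed
    then have "(\<Union>y\<in>U +>\<^bsub>M\<^esub> x. U +>\<^bsub>M\<^esub> (a \<odot>\<^bsub>M\<^esub> y)) = (\<Union>u\<in>U. U +>\<^bsub>M\<^esub> (a \<odot>\<^bsub>M\<^esub> x))"
      by (auto simp: a_r_coset_def'[of M U x])
    also have "\<dots> = U +>\<^bsub>M\<^esub> (a \<odot>\<^bsub>M\<^esub> x)" using submoduleE(2)[OF U] by auto
    finally show ?thesis
      using M.a_coset_join1[OF _ _ sg] M.a_coset_join2[OF _ sg] a x by auto
  qed
  have "a_r_coset (M\<lparr>carrier := Z\<rparr>) = a_r_coset M"
    by (intro ext) (simp add: a_r_coset_def')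
  then show ?thesis
    unfolding annihilates_def quotient_module_def
    using coset Z W by (simp add: A_RCOSETS_def' subset_iff)
qed

lemma mod_homs_module_hom:
  assumes f: "f \<in> mod_homs R M N" and M: "module R M" and N: "module R N"
  shows "\<And>x. x \<in> carrier M \<Longrightarrow> f x \<in> carrier N"
    and "\<And>x y. x \<in> carrier M \<Longrightarrow> y \<in> carrier M \<Longrightarrow> f (x \<oplus>\<^bsub>M\<^esub> y) = f x \<oplus>\<^bsub>N\<^esub> f y"
    and "\<And>a x. a \<in> carrier R \<Longrightarrow> x \<in> carrier M \<Longrightarrow> f (a \<odot>\<^bsub>M\<^esub> x) = a \<odot>\<^bsub>N\<^esub> f x"
    and "f \<zero>\<^bsub>M\<^esub> = \<zero>\<^bsub>N\<^esub>"
    and "\<And>x. x \<in> carrier M \<Longrightarrow> f (\<ominus>\<^bsub>M\<^esub> x) = \<ominus>\<^bsub>N\<^esub> f x"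
proof -
  interpret M: module R M by fact
  interpret N: module R N by fact
  show cl: "\<And>x. x \<in> carrier M \<Longrightarrow> f x \<in> carrier N"
    and ad: "\<And>x y. x \<in> carrier M \<Longrightarrow> y \<in> carrier M \<Longrightarrow> f (x \<oplus>\<^bsub>M\<^esub> y) = f x \<oplus>\<^bsub>N\<^esub> f y"
    and sm: "\<And>a x. a \<in> carrier R \<Longrightarrow> x \<in> carrier M \<Longrightarrow> f (a \<odot>\<^bsub>M\<^esub> x) = a \<odot>\<^bsub>N\<^esub> f x"
    using f unfolding mod_homs_def by auto
  show z: "f \<zero>\<^bsub>M\<^esub> = \<zero>\<^bsub>N\<^esub>"
    using sm[of "\<zero>\<^bsub>R\<^esub>" "\<zero>\<^bsub>M\<^esub>"] cl[of "\<zero>\<^bsub>M\<^esub>"] by simp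
  show "\<And>x. x \<in> carrier M \<Longrightarrow> f (\<ominus>\<^bsub>M\<^esub> x) = \<ominus>\<^bsub>N\<^esub> f x"
    using ad cl z by (metis M.a_inv_closed M.l_neg N.minus_equality)
qed

lemma (in ring) ideal_power_ideal:
  assumes "ideal J R"
  shows "ideal (ideal_power R J n) R"
proof (induction n)
  case 0
  then show ?case by (simp add: ideal_power_def ideals_set_def oneideal)
next
  case (Suc n)
  then show ?case
    using ideal_prod_is_ideal[OF Suc assms] by (simp add: ideal_power_def ideals_set_def)
qed

lemma ideal_power_0: "ideal_power R J 0 = carrier R"
  by (simp add: ideal_power_def ideals_set_def)

lemma ideal_power_Suc: "ideal_power R J (Suc n) = ideal_prod R (ideal_power R J n) J"
  by (simp add: ideal_power_def ideals_set_def)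

lemma (in ring) ideal_power_antimono:
  assumes J: "ideal J R" and "m \<le> n"
  shows "ideal_power R J n \<subseteq> ideal_power R J m"
  using \<open>m \<le> n\<close>
proof (induction n rule: dec_induct)
  case base show ?case ..
next
  case (step n)
  then show ?case
    using ideal_prod_inter[OF ideal_power_ideal[OF J, of n] J] by (auto simp: ideal_power_Suc)
qed

text \<open>
  Closure under addition holds because the powers of an ideal decrease: if \<open>J\<^sup>m\<close> kills \<open>x\<close> and \<open>J\<^sup>n\<close> kills \<open>y\<close>,
  then the larger of the two exponents serves for \<open>x \<oplus> y\<close>.
\<close>
lemma torsion_part_submodule:
  fixes M :: "('r, 'b) module"
  assumes M: "module R M" and J: "ideal J R"
  shows "submodule (torsion_part R J M) R M"
proof -
  interpret module R M by fact
  show ?thesis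
  proof (rule submoduleI)
    have pow: "a \<in> carrier R" if "a \<in> ideal_power R J n" for a n
      using R.ideal_power_ideal[OF J] that by (rule ideal.Icarr)
    show "torsion_part R J M \<subseteq> carrier M" "\<zero>\<^bsub>M\<^esub> \<in> torsion_part R J M"
      unfolding torsion_part_def using pow by auto
    show "\<ominus>\<^bsub>M\<^esub> x \<in> torsion_part R J M" if "x \<in> torsion_part R J M" for x
      using that pow unfolding torsion_part_def by (force simp: smult_r_minus)
    show "x \<oplus>\<^bsub>M\<^esub> y \<in> torsion_part R J M"
      if xy: "x \<in> torsion_part R J M" "y \<in> torsion_part R J M" for x y
    proof -
      obtain m n where m: "\<forall>a\<in>ideal_power R J m. a \<odot>\<^bsub>M\<^esub> x = \<zero>\<^bsub>M\<^esub>"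
        and n: "\<forall>a\<in>ideal_power R J n. a \<odot>\<^bsub>M\<^esub> y = \<zero>\<^bsub>M\<^esub>"
        using xy unfolding torsion_part_def by auto
      have "\<forall>a\<in>ideal_power R J (max m n). a \<odot>\<^bsub>M\<^esub> (x \<oplus>\<^bsub>M\<^esub> y) = \<zero>\<^bsub>M\<^esub>"
        using m n xy pow R.ideal_power_antimono[OF J, of _ "max m n"]
        by (auto simp: smult_r_distr torsion_part_def subset_iff)
      then show ?thesis using xy unfolding torsion_part_def by auto
    qed
    show "w \<odot>\<^bsub>M\<^esub> x \<in> torsion_part R J M" if w: "w \<in> carrier R" and x: "x \<in> torsion_part R J M" for w x
    proof -
      obtain m where m: "\<forall>a\<in>ideal_power R J m. a \<odot>\<^bsub>M\<^esub> x = \<zero>\<^bsub>M\<^esub>" and xM: "x \<in> carrier M"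
        using x unfolding torsion_part_def by auto
      have "a \<odot>\<^bsub>M\<^esub> (w \<odot>\<^bsub>M\<^esub> x) = \<zero>\<^bsub>M\<^esub>" if a: "a \<in> ideal_power R J m" for a
      proof -
        have "a \<odot>\<^bsub>M\<^esub> (w \<odot>\<^bsub>M\<^esub> x) = w \<odot>\<^bsub>M\<^esub> (a \<odot>\<^bsub>M\<^esub> x)"
          using pow[OF a] w xM by (simp add: smult_assoc1[symmetric] R.m_comm)
        then show ?thesis using m a w by simp
      qed
      then show ?thesis using w xM unfolding torsion_part_def by blast
    qed
  qed
qed

lemma submodule_image:
  assumes f: "f \<in> mod_homs R M N" and M: "module R M" and N: "module R N"
    and U: "submodule U R M"
  shows "submodule (f ` U) R N"
proof -
  interpret M: module R M by fact
  interpret N: module R N by fact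
  interpret U: submodule U R M by fact
  note hom = mod_homs_module_hom[OF f M N]
  note sub = M.submoduleE[OF U]
  have zero: "\<zero>\<^bsub>M\<^esub> \<in> U" using subgroup.one_closed[OF U.subgroup_axioms] by simp
  show ?thesis
  proof (rule N.submoduleI)
    show "f ` U \<subseteq> carrier N" using sub(1) hom(1) by auto
    show "\<zero>\<^bsub>N\<^esub> \<in> f ` U" using image_eqI[of _ f "\<zero>\<^bsub>M\<^esub>" U, OF hom(4)[symmetric] zero] .
    show "\<ominus>\<^bsub>N\<^esub> y \<in> f ` U" if "y \<in> f ` U" for y
    proof -
      obtain u where u: "u \<in> U" "y = f u" using \<open>y \<in> f ` U\<close> by blast
      have "f (\<ominus>\<^bsub>M\<^esub> u) = \<ominus>\<^bsub>N\<^esub> y" unfolding u(2) using u(1) sub(1) by (intro hom(5)) blast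
      with sub(3)[OF u(1)] show ?thesis by (metis imageI)
    qed
    show "x \<oplus>\<^bsub>N\<^esub> y \<in> f ` U" if xy: "x \<in> f ` U" "y \<in> f ` U" for x y
    proof -
      obtain u v where uv: "u \<in> U" "x = f u" "v \<in> U" "y = f v" using xy by blast
      have "f (u \<oplus>\<^bsub>M\<^esub> v) = x \<oplus>\<^bsub>N\<^esub> y"
        unfolding uv(2,4) using uv(1,3) sub(1) by (intro hom(2)) blast+
      with sub(5)[OF uv(1,3)] show ?thesis by (metis imageI)
    qed
    show "a \<odot>\<^bsub>N\<^esub> y \<in> f ` U" if a: "a \<in> carrier R" and y: "y \<in> f ` U" for a y
    proof -
      obtain u where u: "u \<in> U" "y = f u" using y by blast
      have "f (a \<odot>\<^bsub>M\<^esub> u) = a \<odot>\<^bsub>N\<^esub> y"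
        unfolding u(2) using a u(1) sub(1) by (intro hom(3)) blast+
      with sub(4)[OF a u(1)] show ?thesis by (metis imageI)
    qed
  qed
qed

definition subring_of_type :: "'c::idom set \<Rightarrow> 'c ring" where
  "subring_of_type C = ring_of_type_algebra\<lparr>carrier := C\<rparr>"

lemma subring_of_type_simps [simp]:
  "carrier (subring_of_type C) = C"
  "x \<otimes>\<^bsub>subring_of_type C\<^esub> y = x * y"
  "x \<oplus>\<^bsub>subring_of_type C\<^esub> y = x + y"
  "\<one>\<^bsub>subring_of_type C\<^esub> = 1"
  "\<zero>\<^bsub>subring_of_type C\<^esub> = 0"
  by (simp_all add: subring_of_type_def ring_of_type_algebra_def)

lemma power_in_ideal_power:
  assumes "ring (subring_of_type C)" and J: "ideal J (subring_of_type C)" and c: "c \<in> J"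
  shows "c ^ n \<in> ideal_power (subring_of_type C) J n"
proof (induction n)
  case 0
  interpret ring "subring_of_type C" by fact
  show ?case using one_closed by (simp add: ideal_power_0)
next
  case (Suc n)
  then show ?case
    using ideal_prod.prod[OF Suc c, of "subring_of_type C"]
    by (simp add: ideal_power_Suc mult.commute)
qed

text \<open>
  The domain that contains \<open>C\<close>, as a module over \<open>subring_of_type C\<close>. Its elements have the
  element type of \<open>C\<close>, so the extension property of \<open>injective_module\<close> applies to it.
\<close>
definition ambient_module :: "('c::idom, 'c) module" where
  "ambient_module =
     \<lparr>carrier = UNIV, monoid.mult = (*), one = 1, zero = 0, add = (+), module.smult = (*)\<rparr>"

lemma ambient_module_simps [simp]:
  "carrier ambient_module = UNIV" "\<zero>\<^bsub>ambient_module\<^esub> = 0"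
  "x \<oplus>\<^bsub>ambient_module\<^esub> y = x + y" "x \<odot>\<^bsub>ambient_module\<^esub> y = x * y"
  by (simp_all add: ambient_module_def)

lemma regular_module_simps [simp]:
  "carrier (regular_module R) = carrier R" "\<zero>\<^bsub>regular_module R\<^esub> = \<zero>\<^bsub>R\<^esub>"
  "x \<oplus>\<^bsub>regular_module R\<^esub> y = x \<oplus>\<^bsub>R\<^esub> y" "x \<odot>\<^bsub>regular_module R\<^esub> y = x \<otimes>\<^bsub>R\<^esub> y"
  by (simp_all add: regular_module_def)

lemma ambient_module_module:
  assumes "cring (subring_of_type C)"
  shows "module (subring_of_type C) ambient_module"
proof (rule moduleI)
  show "abelian_group (ambient_module :: ('a, 'a) module)"
    by (rule abelian_groupI) (auto simp: algebra_simps intro: exI[of _ "- x" for x] add.left_inverse)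
qed (use assms in \<open>auto simp: algebra_simps\<close>)

text \<open>
  This is the identification of \<open>H\<^sup>1\<close> with \<open>{z. J\<^sup>n z \<subseteq> C for some n} / C\<close>, stated for annihilators
  only, where \<open>z\<close> ranges over the ambient domain. Injectivity of \<open>I 0\<close> extends the augmentation
  \<open>e\<close> from \<open>C\<close> to an \<open>R\<close>-linear map \<open>g\<close> on the ambient ring, and \<open>d 0 (g z)\<close> is a torsion
  cocycle as soon as \<open>J\<^sup>n z \<subseteq> C\<close>. Its multiple by \<open>w\<close> is a coboundary only if
  \<open>g (w z)\<close> differs from some \<open>e v\<close> by a torsion element; a power of \<open>a\<close> kills that element and, \<open>e\<close>
  being injective and the ring a domain, \<open>w z = v\<close> lies in \<open>C\<close>.

  Every torsion cocycle arises in this way modulo coboundaries. It is \<open>d 0 y\<close> with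
  \<open>J\<^sup>n y \<subseteq> e C\<close>, so \<open>y\<close> acts on \<open>J\<^sup>n\<close> like a fraction. Its numerators over \<open>a\<^sup>n\<close> and over \<open>b\<^sup>n\<close>
  give the same fraction, and the coprimality hypothesis makes it an element \<open>z\<close> of the ambient
  ring; then \<open>y - g z\<close> is torsion.
\<close>
theorem annihilates_local_cohomology_1_iff:
  fixes C J W :: "'c::idom set"
  defines "R \<equiv> subring_of_type C"
  assumes res: "injective_resolution R (regular_module R) e I d"
    and J: "ideal J R" and a: "a \<in> J" "a \<noteq> 0" and b: "b \<in> J"
    and coprime: "\<And>n f g. b ^ n * f = a ^ n * g \<Longrightarrow> a ^ n dvd f"
    and W: "W \<subseteq> C"
  shows "annihilates W (local_cohomology R J I d 1) \<longleftrightarrow>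
         (\<forall>z. (\<exists>n. \<forall>p\<in>ideal_power R J n. p * z \<in> C) \<longrightarrow> (\<forall>w\<in>W. w * z \<in> C))"
proof -
  have [simp]: "carrier R = C" "\<And>x y. x \<otimes>\<^bsub>R\<^esub> y = x * y" "\<And>x y. x \<oplus>\<^bsub>R\<^esub> y = x + y" "\<zero>\<^bsub>R\<^esub> = 0"
    unfolding R_def by simp_all
  have RM: "module R (regular_module R)" and inj: "\<And>n. injective_module R (I n)"
    and e: "e \<in> mod_homs R (regular_module R) (I 0)" and e_inj: "inj_on e C"
    and d: "\<And>n. d n \<in> mod_homs R (I n) (I (Suc n))"
    and ker0: "{x \<in> carrier (I 0). d 0 x = \<zero>\<^bsub>I 1\<^esub>} = e ` C"
    and ker1: "{x \<in> carrier (I 1). d 1 x = \<zero>\<^bsub>I 2\<^esub>} = d 0 ` carrier (I 0)"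
    using res unfolding injective_resolution_def by (auto simp: numeral_2_eq_2)
  have modI: "module R (I n)" for n using inj unfolding injective_module_def by blast
  interpret regular: module R "regular_module R" by fact
  interpret I0: module R "I 0" by (rule modI)
  interpret I1: module R "I 1" by (rule modI)
  have d0: "d 0 \<in> mod_homs R (I 0) (I 1)" using d[of 0] by simp
  note e_hom = mod_homs_module_hom[OF e RM modI, simplified]
  note d0_hom = mod_homs_module_hom[OF d0 modI modI]
  have d0_e: "d 0 (e x) = \<zero>\<^bsub>I 1\<^esub>" if "x \<in> C" for x using ker0 that by blast
  have pow: "p \<in> C" if "p \<in> ideal_power R J n" for p n
    using ideal.Icarr[OF regular.ideal_power_ideal[OF J] that] by simp
  have power_mem: "c ^ n \<in> ideal_power R J n" if "c \<in> J" for c n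
    unfolding R_def
    by (rule power_in_ideal_power[OF _ _ that])
      (use regular.R.ring_axioms J in \<open>simp_all add: R_def\<close>)
  \<comment> \<open>The extension \<open>g\<close> of \<open>e\<close> along the inclusion of \<open>C\<close> into the ambient ring.\<close>
  have "\<exists>g \<in> mod_homs R ambient_module (I 0). \<forall>x\<in>C. g x = e x"
  proof -
    have B: "module R ambient_module"
      unfolding R_def by (rule ambient_module_module) (use module.axioms(1)[OF RM] in \<open>simp add: R_def\<close>)
    have i: "id \<in> mod_homs R (regular_module R) ambient_module" "inj_on id (carrier (regular_module R))"
      by (auto simp: mod_homs_def)
    show ?thesis
      using inj[of 0, unfolded injective_module_def, THEN conjunct2, rule_format,
          of "regular_module R" ambient_module id e] RM B i e by auto
  qed
  then obtain g where g: "g \<in> mod_homs R ambient_module (I 0)" and g_e: "\<And>x. x \<in> C \<Longrightarrow> g x = e x"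
    by blast
  have g_cl: "g x \<in> carrier (I 0)" and g_add: "g (x + y) = g x \<oplus>\<^bsub>I 0\<^esub> g y"
    and g_smult: "p \<in> C \<Longrightarrow> g (p * x) = p \<odot>\<^bsub>I 0\<^esub> g x" for x y p
    using g unfolding mod_homs_def by auto
  let ?T = "torsion_part R J (I 0)"
  have T: "submodule ?T R (I 0)" by (rule torsion_part_submodule[OF modI J])
  have Z: "torsion_cocycles R J I d 1 =
      {x \<in> carrier (I 1). (\<exists>n. \<forall>p\<in>ideal_power R J n. p \<odot>\<^bsub>I 1\<^esub> x = \<zero>\<^bsub>I 1\<^esub>) \<and> d 1 x = \<zero>\<^bsub>I 2\<^esub>}"
    unfolding torsion_cocycles_def torsion_part_def by (auto simp: numeral_2_eq_2)
  (* Keeps I 1 in the form in which the facts above mention it. *)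
  note One_nat_def [simp del]
  have "annihilates W (local_cohomology R J I d 1) \<longleftrightarrow>
      (\<forall>w\<in>W. \<forall>x\<in>torsion_cocycles R J I d 1. w \<odot>\<^bsub>I 1\<^esub> x \<in> d 0 ` ?T)"
    unfolding local_cohomology_def torsion_coboundaries_def
    using annihilates_quotient_module_iff[OF modI[of 1], of "d 0 ` ?T" "torsion_cocycles R J I d 1" W]
      submodule_image[OF d0 modI modI T] Z W by (auto simp: One_nat_def)
  also have "\<dots> \<longleftrightarrow> (\<forall>z. (\<exists>n. \<forall>p\<in>ideal_power R J n. p * z \<in> C) \<longrightarrow> (\<forall>w\<in>W. w * z \<in> C))"
  proof (intro iffI allI impI ballI)
    fix z w
    assume ann: "\<forall>w\<in>W. \<forall>x\<in>torsion_cocycles R J I d 1. w \<odot>\<^bsub>I 1\<^esub> x \<in> d 0 ` ?T"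
      and z: "\<exists>n. \<forall>p\<in>ideal_power R J n. p * z \<in> C" and w: "w \<in> W"
    have wC: "w \<in> C" using w W by auto
    obtain n where n: "\<And>p. p \<in> ideal_power R J n \<Longrightarrow> p * z \<in> C" using z by blast
    have "d 0 (g z) \<in> torsion_cocycles R J I d 1"
    proof -
      have "p \<odot>\<^bsub>I 1\<^esub> d 0 (g z) = \<zero>\<^bsub>I 1\<^esub>" if p: "p \<in> ideal_power R J n" for p
      proof -
        have "p \<odot>\<^bsub>I 1\<^esub> d 0 (g z) = d 0 (g (p * z))"
          using d0_hom(3)[of p "g z"] g_smult[of p z] g_cl pow[OF p] by simp
        then show ?thesis using g_e d0_e n[OF p] by simp
      qed
      then show ?thesis using ker1 g_cl d0_hom(1) unfolding Z by blast
    qed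
    then have "w \<odot>\<^bsub>I 1\<^esub> d 0 (g z) \<in> d 0 ` ?T" using ann w by blast
    then obtain t where t: "t \<in> ?T" "d 0 (g (w * z)) = d 0 t"
      using d0_hom(3)[of w "g z"] g_cl g_smult[OF wC] wC by auto
    have t0: "t \<in> carrier (I 0)" using t(1) unfolding torsion_part_def by simp
    have "d 0 (g (w * z) \<ominus>\<^bsub>I 0\<^esub> t) = \<zero>\<^bsub>I 1\<^esub>"
      using t0 g_cl t(2) d0_hom by (simp add: a_minus_def I1.r_neg)
    then obtain v where v: "v \<in> C" "g (w * z) \<ominus>\<^bsub>I 0\<^esub> t = e v"
      using ker0 t0 g_cl by blast
    have gwz: "g (w * z) = e v \<oplus>\<^bsub>I 0\<^esub> t"
      using v(2)[symmetric] t0 g_cl by (simp add: a_minus_def I0.a_assoc I0.l_neg)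
    obtain m where m: "\<And>p. p \<in> ideal_power R J m \<Longrightarrow> p \<odot>\<^bsub>I 0\<^esub> t = \<zero>\<^bsub>I 0\<^esub>"
      using t(1) unfolding torsion_part_def by blast
    \<comment> \<open>A nonzero multiplier that kills the torsion element \<open>t\<close> and carries \<open>z\<close> into \<open>C\<close>.\<close>
    define c where "c = a ^ max m n"
    have "c \<in> ideal_power R J (max m n)" unfolding c_def by (rule power_mem[OF a(1)])
    then have c: "c \<in> ideal_power R J m" "c \<in> ideal_power R J n"
      using regular.ideal_power_antimono[OF J, of m "max m n"]
        regular.ideal_power_antimono[OF J, of n "max m n"] by auto
    have c0: "c \<noteq> 0" using a(2) by (simp add: c_def)
    note cC = pow[OF c(1)]
    have cwz: "c * (w * z) \<in> C"
      using regular.R.m_closed[of w "c * z"] n[OF c(2)] wC by (simp add: ac_simps)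
    have cv: "c * v \<in> C" using regular.R.m_closed[of c v] cC v(1) by simp
    have "e (c * (w * z)) = c \<odot>\<^bsub>I 0\<^esub> g (w * z)"
      using g_smult[OF cC] g_e[OF cwz] by metis
    also have "\<dots> = e (c * v)"
      unfolding gwz using m[OF c(1)] cC v(1) t0 e_hom by (simp add: I0.smult_r_distr)
    finally have "c * (w * z) = c * v" by (rule inj_onD[OF e_inj _ cwz cv])
    then show "w * z \<in> C" using c0 v(1) by simp
  next
    fix w x
    assume all: "\<forall>z. (\<exists>n. \<forall>p\<in>ideal_power R J n. p * z \<in> C) \<longrightarrow> (\<forall>w\<in>W. w * z \<in> C)"
      and w: "w \<in> W" and x: "x \<in> torsion_cocycles R J I d 1"
    have wC: "w \<in> C" using w W by auto
    obtain y where y: "y \<in> carrier (I 0)" "x = d 0 y"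
      using x ker1 unfolding Z by blast
    obtain n where n: "\<And>p. p \<in> ideal_power R J n \<Longrightarrow> p \<odot>\<^bsub>I 1\<^esub> x = \<zero>\<^bsub>I 1\<^esub>"
      using x unfolding Z by blast
    have "\<exists>f\<in>C. p \<odot>\<^bsub>I 0\<^esub> y = e f" if p: "p \<in> ideal_power R J n" for p
    proof -
      have "d 0 (p \<odot>\<^bsub>I 0\<^esub> y) = \<zero>\<^bsub>I 1\<^esub>" using n[OF p] pow[OF p] y d0_hom(3) by simp
      then have "p \<odot>\<^bsub>I 0\<^esub> y \<in> {x \<in> carrier (I 0). d 0 x = \<zero>\<^bsub>I 1\<^esub>}"
        using pow[OF p] y(1) by simp
      then show ?thesis unfolding ker0 by blast
    qed
    then obtain f where f: "\<And>p. p \<in> ideal_power R J n \<Longrightarrow> f p \<in> C"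
      "\<And>p. p \<in> ideal_power R J n \<Longrightarrow> p \<odot>\<^bsub>I 0\<^esub> y = e (f p)" by metis
    \<comment> \<open>The ratio \<open>f p / p\<close> is the same for all \<open>p\<close>.\<close>
    have swap: "q * f p = p * f q" if p: "p \<in> ideal_power R J n" and q: "q \<in> ideal_power R J n" for p q
    proof -
      have "e (q * f p) = (q * p) \<odot>\<^bsub>I 0\<^esub> y"
        using f[OF p] pow[OF p] pow[OF q] y(1) e_hom(3) I0.smult_assoc1[of q p y] by simp
      also have "\<dots> = e (p * f q)"
        using f[OF q] pow[OF p] pow[OF q] y(1) e_hom(3) I0.smult_assoc1[of p q y]
        by (simp add: mult.commute)
      finally have eq: "e (q * f p) = e (p * f q)" .
      have "q * f p \<in> C" "p * f q \<in> C"
        using regular.R.m_closed[of q "f p"] regular.R.m_closed[of p "f q"]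
          f(1)[OF p] f(1)[OF q] pow[OF p] pow[OF q] by simp_all
      then show ?thesis by (rule inj_onD[OF e_inj eq])
    qed
    note an = power_mem[OF a(1), of n] and bn = power_mem[OF b, of n]
    obtain z where z: "f (a ^ n) = a ^ n * z"
      using coprime[OF swap[OF an bn]] by (rule dvdE)
    have fz: "f p = p * z" if p: "p \<in> ideal_power R J n" for p
    proof -
      have "a ^ n * f p = a ^ n * (p * z)" using swap[OF p an] z by (simp add: ac_simps)
      then show ?thesis using a(2) by simp
    qed
    then have pz: "\<And>p. p \<in> ideal_power R J n \<Longrightarrow> p * z \<in> C" using f(1) by force
    then have wz: "w * z \<in> C" using all w by blast
    have t: "y \<ominus>\<^bsub>I 0\<^esub> g z \<in> ?T"
    proof -
      have "p \<odot>\<^bsub>I 0\<^esub> (y \<ominus>\<^bsub>I 0\<^esub> g z) = \<zero>\<^bsub>I 0\<^esub>" if p: "p \<in> ideal_power R J n" for p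
        using y(1) g_cl pow[OF p] f(2)[OF p] fz[OF p] g_smult[OF pow[OF p], of z]
          g_e[OF pz[OF p]] e_hom(1)[OF pz[OF p]]
        by (simp add: a_minus_def I0.smult_r_distr I0.smult_r_minus I0.r_neg)
      then show ?thesis using y(1) g_cl unfolding torsion_part_def by auto
    qed
    have "w \<odot>\<^bsub>I 0\<^esub> (y \<ominus>\<^bsub>I 0\<^esub> g z) = w \<odot>\<^bsub>I 0\<^esub> y \<ominus>\<^bsub>I 0\<^esub> e (w * z)"
      using y(1) g_cl wC g_smult[OF wC, of z] g_e[OF wz]
      by (simp add: a_minus_def I0.smult_r_distr I0.smult_r_minus)
    then have "d 0 (w \<odot>\<^bsub>I 0\<^esub> (y \<ominus>\<^bsub>I 0\<^esub> g z)) = w \<odot>\<^bsub>I 1\<^esub> x"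
      using y wC e_hom(1)[OF wz] d0_hom d0_e[OF wz] by (simp add: a_minus_def)
    moreover have "w \<odot>\<^bsub>I 0\<^esub> (y \<ominus>\<^bsub>I 0\<^esub> g z) \<in> ?T"
      using I0.submoduleE(4)[OF T _ t] wC by simp
    ultimately show "w \<odot>\<^bsub>I 1\<^esub> x \<in> d 0 ` ?T" by (metis imageI)
  qed
  finally show ?thesis .
qed

section \<open>The exponent semigroup and its gaps\<close>

text \<open>
  The exponents of \<open>s\<close> and \<open>t\<close> in the products of the generators; \<open>a\<close>, \<open>\<alpha>\<close>, \<open>\<beta>\<close>, \<open>\<gamma>\<close>, \<open>\<delta>\<close> are the
  multiplicities of the generators, from \<open>s\<^bsup>2r+1\<^esup>\<close> to \<open>t\<^bsup>2r+1\<^esup>\<close>.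
\<close>
definition curve_exponents :: "nat \<Rightarrow> (nat \<times> nat) set" where
  "curve_exponents r = {(i, j). \<exists>a \<alpha> \<beta> \<gamma> \<delta>.
     i = (2 * r + 1) * a + (r + 1) * \<alpha> + 3 * \<beta> + 2 * \<gamma> \<and>
     j = r * \<alpha> + (2 * r - 2) * \<beta> + (2 * r - 1) * \<gamma> + (2 * r + 1) * \<delta>}"

lemma curve_exponentsI:
  assumes "i = (2 * r + 1) * a + (r + 1) * \<alpha> + 3 * \<beta> + 2 * \<gamma>"
    and "j = r * \<alpha> + (2 * r - 2) * \<beta> + (2 * r - 1) * \<gamma> + (2 * r + 1) * \<delta>"
  shows "(i, j) \<in> curve_exponents r"
  using assms unfolding curve_exponents_def by blast

lemma curve_exponentsE:
  assumes "(i, j) \<in> curve_exponents r"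
  obtains a \<alpha> \<beta> \<gamma> \<delta> where
    "i = (2 * r + 1) * a + (r + 1) * \<alpha> + 3 * \<beta> + 2 * \<gamma>"
    "j = r * \<alpha> + (2 * r - 2) * \<beta> + (2 * r - 1) * \<gamma> + (2 * r + 1) * \<delta>"
  using assms unfolding curve_exponents_def by blast

lemma curve_exponents_0: "(0, 0) \<in> curve_exponents r"
  by (rule curve_exponentsI[of _ _ 0 0 0 0 _ 0]) auto

lemma curve_exponents_add:
  assumes "(i, j) \<in> curve_exponents r" "(i', j') \<in> curve_exponents r"
  shows "(i + i', j + j') \<in> curve_exponents r"
proof -
  obtain a \<alpha> \<beta> \<gamma> \<delta> where 1:
    "i = (2 * r + 1) * a + (r + 1) * \<alpha> + 3 * \<beta> + 2 * \<gamma>"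
    "j = r * \<alpha> + (2 * r - 2) * \<beta> + (2 * r - 1) * \<gamma> + (2 * r + 1) * \<delta>"
    using assms(1) by (rule curve_exponentsE)
  obtain a' \<alpha>' \<beta>' \<gamma>' \<delta>' where 2:
    "i' = (2 * r + 1) * a' + (r + 1) * \<alpha>' + 3 * \<beta>' + 2 * \<gamma>'"
    "j' = r * \<alpha>' + (2 * r - 2) * \<beta>' + (2 * r - 1) * \<gamma>' + (2 * r + 1) * \<delta>'"
    using assms(2) by (rule curve_exponentsE)
  show ?thesis
    by (rule curve_exponentsI[of _ _ "a + a'" "\<alpha> + \<alpha>'" "\<beta> + \<beta>'" "\<gamma> + \<gamma>'" _ "\<delta> + \<delta>'"])
      (simp_all only: 1 2 add_mult_distrib add_mult_distrib2 ac_simps)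
qed

lemma curve_exponents_t: "(0, (2 * r + 1) * m) \<in> curve_exponents r"
  by (rule curve_exponentsI[of _ _ 0 0 0 0 _ m]) auto

lemma curve_exponents_s: "((2 * r + 1) * m, 0) \<in> curve_exponents r"
  by (rule curve_exponentsI[of _ _ m 0 0 0 _ 0]) auto

lemma twos_and_threes:
  fixes i m :: nat
  assumes "i \<noteq> 1" "i \<le> 3 * m"
  obtains \<beta> \<gamma> where "i = 3 * \<beta> + 2 * \<gamma>" "\<beta> + \<gamma> \<le> m"
proof -
  consider "i mod 3 = 0" | "i mod 3 = 1" | "i mod 3 = 2" by linarith
  then show thesis
  proof cases
    case 1 then show ?thesis using assms by (intro that[of "i div 3" 0]) presburger+
  next
    case 2 then show ?thesis using assms by (intro that[of "i div 3 - 1" 2]) presburger+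
  next
    case 3 then show ?thesis using assms by (intro that[of "i div 3" 1]) presburger+
  qed
qed

text \<open>
  All generators have total degree \<open>2r + 1\<close>. Once the exponent of \<open>s\<close> is spent on \<open>\<beta> + \<gamma> \<le> N\<close>
  generators, copies of \<open>t\<^bsup>2r+1\<^esup>\<close> fill the degree up to \<open>N\<close>, so the exponent of \<open>t\<close> comes out right.
\<close>
lemma degree_exponent:
  fixes r :: nat
  assumes "1 \<le> r" "\<beta> + \<gamma> \<le> N" "3 * \<beta> + 2 * \<gamma> + j = (2 * r + 1) * N"
  shows "j = (2 * r - 2) * \<beta> + (2 * r - 1) * \<gamma> + (2 * r + 1) * (N - \<beta> - \<gamma>)"
proof -
  obtain q where r: "r = Suc q" using assms(1) by (cases r) auto
  obtain l where N: "N = \<beta> + \<gamma> + l" using assms(2) le_Suc_ex by blast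
  show ?thesis using assms(3) by (simp add: r N algebra_simps)
qed

text \<open>
  Among the generators, \<open>s\<^sup>3 t\<^bsup>2r-2\<^esup>\<close> and \<open>s\<^sup>2 t\<^bsup>2r-1\<^esup>\<close> produce small exponents of \<open>s\<close>. In degree
  \<open>N\<close> they reach every exponent of \<open>s\<close> up to \<open>3 N\<close> except \<open>1\<close>.
\<close>
lemma in_exponents_if_few_steps:
  assumes "1 \<le> r" "i + j = (2 * r + 1) * N" "i \<noteq> 1" "i \<le> 3 * N"
  shows "(i, j) \<in> curve_exponents r"
proof -
  obtain \<beta> \<gamma> where bg: "i = 3 * \<beta> + 2 * \<gamma>" "\<beta> + \<gamma> \<le> N"
    using twos_and_threes[OF assms(3,4)] .
  then show ?thesis
    using degree_exponent[of r \<beta> \<gamma> N j] assms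
    by (intro curve_exponentsI[of _ _ 0 0 \<beta> \<gamma> _ "N - \<beta> - \<gamma>"]) auto
qed

text \<open>
  The hypotheses describe the saturation one coordinate at a time: \<open>j\<close> is a sum of \<open>t\<close>-exponents of
  generators, and \<open>i \<noteq> 1\<close> says the same of \<open>i\<close> and \<open>s\<close>-exponents. The two sums may use different
  generators; \<open>e\<close> is the excess of the number of generators in the first sum over the degree \<open>N\<close>. If \<open>e \<le> 0\<close>, copies of
  \<open>s\<^bsup>2r+1\<^esup>\<close> make up the difference. Otherwise, after removing copies of \<open>s\<^bsup>2r+1\<^esup>\<close>, the bound
  on \<open>\<alpha>\<close> that \<open>i \<le> 2 r\<close> imposes makes \<open>N\<close> so large that \<open>i\<close> is within reach of twos and threes,
  starting from \<open>0\<close> if \<open>i \<le> r\<close> and from the generator \<open>s\<^bsup>r+1\<^esup>t\<^sup>r\<close> if \<open>i > r\<close>. The second start fails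
  for \<open>i = r + 2\<close> alone, as the remainder \<open>1\<close> is not a sum of twos and threes. The gaps are in
  that column, below the degree at which \<open>r + 2\<close> itself is within reach.
\<close>
lemma saturation_cases:
  fixes r i j N :: nat
  assumes r: "r \<ge> 5" and deg: "i + j = (2 * r + 1) * N" and "i \<noteq> 1"
    and j: "j = r * \<alpha> + (2 * r - 2) * \<beta> + (2 * r - 1) * \<gamma> + (2 * r + 1) * \<delta>"
  shows "(i, j) \<in> curve_exponents r \<or> (\<exists>m. 3 * m + 5 \<le> r \<and> i = r + 2 \<and> j = 3 * r + (2 * r + 1) * m)"
  using deg \<open>i \<noteq> 1\<close>
proof (induction i arbitrary: N rule: less_induct)
  case (less i)
  define e where "e = int \<alpha> + int \<beta> + int \<gamma> + int \<delta> - int N"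
  obtain q where q: "r = Suc q" using r by (cases r) auto
  have i: "int i = (int r + 1) * int \<alpha> + 3 * int \<beta> + 2 * int \<gamma> - e * (2 * int r + 1)"
  proof -
    have "int i = (2 * int r + 1) * int N - int j"
      using arg_cong[OF less.prems(1), of int] by (simp add: algebra_simps)
    then show ?thesis unfolding j e_def by (simp add: q algebra_simps)
  qed
  have bound: "3 * int N - int i = int \<gamma> + 3 * int \<delta> + (2 * int r - 2) * e - (int r - 2) * int \<alpha>"
    unfolding i e_def by (simp add: algebra_simps)
  consider "i \<ge> 2 * r + 1" | "i \<le> 2 * r" "e \<le> 0" | "i \<le> r" "e \<ge> 1" | "r < i" "i \<le> 2 * r" "e \<ge> 1"
    by linarith
  then show ?case
  proof cases
    case 1
    then obtain i' where i': "i = (2 * r + 1) + i'" using le_Suc_ex by blast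
    obtain N' where N': "N = Suc N'"
      using less.prems(1) 1 by (cases N) auto
    have deg': "i' + j = (2 * r + 1) * N'" using less.prems(1) by (simp add: i' N')
    show ?thesis
    proof (cases "i' = 1")
      case True
      \<comment> \<open>Subtracting \<open>2r + 1\<close> would leave the forbidden exponent \<open>1\<close>, but \<open>2 r + 2 = 2 (r + 1)\<close>.\<close>
      obtain N'' where N'': "N' = Suc N''" using deg' True by (cases N') auto
      show ?thesis
        using deg' by (intro disjI1 curve_exponentsI[of _ _ 0 2 0 0 _ "N''"]) (auto simp: True i' N'')
    next
      case False
      have "(i', j) \<in> curve_exponents r \<or> (\<exists>m. 3 * m + 5 \<le> r \<and> i' = r + 2 \<and> j = 3 * r + (2 * r + 1) * m)"
        using less.IH[of i' N'] deg' False i' by simp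
      then show ?thesis
      proof (elim disjE exE conjE)
        assume "(i', j) \<in> curve_exponents r"
        then show ?thesis
          using curve_exponents_add[OF curve_exponents_s[of r 1], of i' j] by (simp add: i')
      next
        \<comment> \<open>A gap is filled by \<open>s\<^bsup>2r+1\<^esup>\<close>, since \<open>(r + 2) + (2 r + 1) = 3 (r + 1)\<close>.\<close>
        fix m assume "i' = r + 2" "j = 3 * r + (2 * r + 1) * m"
        then show ?thesis
          by (intro disjI1 curve_exponentsI[of _ _ 0 3 0 0 _ m]) (auto simp: i')
      qed
    qed
  next
    case 2
    have "int i = (2 * int r + 1) * int (nat (- e)) + (int r + 1) * int \<alpha> + 3 * int \<beta> + 2 * int \<gamma>"
      using i 2 by (simp add: algebra_simps)
    then have "i = (2 * r + 1) * nat (- e) + (r + 1) * \<alpha> + 3 * \<beta> + 2 * \<gamma>"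
      by (simp only: of_nat_eq_iff[where 'a=int, symmetric] of_nat_add of_nat_mult of_nat_1 of_nat_numeral)
    then show ?thesis using j by (intro disjI1 curve_exponentsI)
  next
    case 3
    have "int \<alpha> \<le> 2 * e"
    proof (rule ccontr)
      assume "\<not> ?thesis"
      then have "(int r + 1) * (2 * e + 1) \<le> (int r + 1) * int \<alpha>" by (intro mult_left_mono) auto
      then show False using i 3 by (simp add: algebra_simps)
    qed
    then have "(int r - 2) * int \<alpha> \<le> (int r - 2) * (2 * e)" using r by (intro mult_left_mono) auto
    then have "int i \<le> 3 * int N" using bound 3 by (simp add: algebra_simps)
    then show ?thesis using in_exponents_if_few_steps[of r i j N] r less.prems by simp
  next
    case 4
    have "int \<alpha> \<le> 2 * e + 1"
    proof (rule ccontr)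
      assume "\<not> ?thesis"
      then have "(int r + 1) * (2 * e + 2) \<le> (int r + 1) * int \<alpha>" by (intro mult_left_mono) auto
      then show False using i 4 by (simp add: algebra_simps)
    qed
    then have "(int r - 2) * int \<alpha> \<le> (int r - 2) * (2 * e + 1)" using r by (intro mult_left_mono) auto
    then have le: "int i \<le> 3 * int N + int r - 2" using bound 4 by (simp add: algebra_simps)
    obtain N' where N': "N = Suc N'"
      using less.prems(1) 4 by (cases N) auto
    obtain i' where i': "i = (r + 1) + i'" using 4 le_Suc_ex[of "r + 1" i] by auto
    show ?thesis
    proof (cases "i' = 1")
      case False
      have "i' \<le> 3 * N'" using le by (simp add: i' N')
      then obtain \<beta>' \<gamma>' where bg: "i' = 3 * \<beta>' + 2 * \<gamma>'" "\<beta>' + \<gamma>' \<le> N'"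
        using twos_and_threes[OF False] by blast
      have "3 * N' \<le> (2 * r + 1) * N'" using r by (intro mult_right_mono) auto
      moreover have "(2 * r + 1) * N = (2 * r + 1) + (2 * r + 1) * N'" by (simp add: N')
      ultimately have "j \<ge> r" using less.prems(1) \<open>i' \<le> 3 * N'\<close> i' by linarith
      then obtain j' where j': "j = r + j'" using le_Suc_ex by blast
      have jj: "j' = (2 * r - 2) * \<beta>' + (2 * r - 1) * \<gamma>' + (2 * r + 1) * (N' - \<beta>' - \<gamma>')"
        using degree_exponent[of r \<beta>' \<gamma>' N' j'] less.prems(1) r bg by (simp add: N' i' j')
      then show ?thesis
        using bg(1) i' j'
        by (intro disjI1 curve_exponentsI[of _ _ 0 1 \<beta>' \<gamma>' _ "N' - \<beta>' - \<gamma>'"])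
          (simp_all only: mult_1_right mult_0_right add_0 add.assoc)
    next
      case True
      obtain m where m: "N = 2 + m" using le True i' N' by (cases N') auto
      show ?thesis
      proof (cases "3 * m + 5 \<le> r")
        case True
        then show ?thesis using less.prems(1) \<open>i' = 1\<close> by (auto simp: i' m algebra_simps)
      next
        case False
        then have "i \<le> 3 * N" using True i' m by simp
        then show ?thesis using in_exponents_if_few_steps[of r i j N] r less.prems by simp
      qed
    qed
  qed
qed

lemma curve_exponents_degree:
  assumes "(i, j) \<in> curve_exponents r" "r \<ge> 1"
  shows "\<exists>N. i + j = (2 * r + 1) * N"
proof -
  obtain q where q: "r = Suc q" using assms(2) by (cases r) auto
  obtain a \<alpha> \<beta> \<gamma> \<delta> where
    "i = (2 * r + 1) * a + (r + 1) * \<alpha> + 3 * \<beta> + 2 * \<gamma>"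
    "j = r * \<alpha> + (2 * r - 2) * \<beta> + (2 * r - 1) * \<gamma> + (2 * r + 1) * \<delta>"
    using assms(1) by (rule curve_exponentsE)
  then have "i + j = (2 * r + 1) * (a + \<alpha> + \<beta> + \<gamma> + \<delta>)"
    by (simp add: q algebra_simps)
  then show ?thesis ..
qed

text \<open>
  The pairs that enter the exponent set after adding a multiple of \<open>(2r + 1, 0)\<close> and also after
  adding a multiple of \<open>(0, 2r + 1)\<close> index the monomials that represent classes of \<open>H\<^sup>1\<close>.
\<close>
lemma saturation_gaps:
  assumes r: "r \<ge> 5"
    and s: "((2 * r + 1) * n + i, j) \<in> curve_exponents r"
    and t: "(i, (2 * r + 1) * n + j) \<in> curve_exponents r"
  shows "(i, j) \<in> curve_exponents r \<or> (\<exists>m. 3 * m + 5 \<le> r \<and> i = r + 2 \<and> j = 3 * r + (2 * r + 1) * m)"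
proof -
  obtain a \<alpha> \<beta> \<gamma> \<delta> where
    j: "j = r * \<alpha> + (2 * r - 2) * \<beta> + (2 * r - 1) * \<gamma> + (2 * r + 1) * \<delta>"
    using s by (rule curve_exponentsE)
  have "i \<noteq> 1"
  proof -
    obtain a \<alpha> \<beta> \<gamma> where
      "i = (2 * r + 1) * a + (r + 1) * \<alpha> + 3 * \<beta> + 2 * \<gamma>"
      using t by (rule curve_exponentsE)
    moreover have no: "3 * \<beta> + 2 * \<gamma> \<noteq> Suc 0" by presburger
    ultimately show ?thesis using r no by (cases a; cases \<alpha>) auto
  qed
  moreover obtain N where "(2 * r + 1) * n + i + j = (2 * r + 1) * N"
    using curve_exponents_degree[OF s] r by auto
  then have "i + j = (2 * r + 1) * (N - n)"
    by (simp only: diff_mult_distrib2)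
  ultimately show ?thesis using saturation_cases[OF r _ _ j] by blast
qed

text \<open>
  The exponent \<open>r + 2\<close> of \<open>s\<close> leaves no room for \<open>s\<^bsup>2r+1\<^esup>\<close>, nor for \<open>s\<^bsup>r+1\<^esup>t\<^sup>r\<close>, which would leave a
  remainder \<open>1\<close>. So it is a sum of twos and threes, of which the degree \<open>m + 2\<close> allows \<open>m + 2\<close>; the
  condition on \<open>m\<close> is \<open>r + 2 \<le> 3 (m + 2)\<close>.
\<close>
lemma gap_in_exponents_iff:
  assumes r: "r \<ge> 5"
  shows "(r + 2, 3 * r + (2 * r + 1) * m) \<in> curve_exponents r \<longleftrightarrow> r < 3 * m + 5"
proof
  assume "r < 3 * m + 5"
  then show "(r + 2, 3 * r + (2 * r + 1) * m) \<in> curve_exponents r"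
    using r by (intro in_exponents_if_few_steps[of r _ _ "m + 2"]) (auto simp: algebra_simps)
next
  assume "(r + 2, 3 * r + (2 * r + 1) * m) \<in> curve_exponents r"
  then obtain a \<alpha> \<beta> \<gamma> \<delta> where i:
    "r + 2 = (2 * r + 1) * a + (r + 1) * \<alpha> + 3 * \<beta> + 2 * \<gamma>"
    and j: "3 * r + (2 * r + 1) * m = r * \<alpha> + (2 * r - 2) * \<beta> + (2 * r - 1) * \<gamma> + (2 * r + 1) * \<delta>"
    by (rule curve_exponentsE)
  obtain q where q: "r = Suc q" using r by (cases r) auto
  have "a = 0" using i r by (cases a) auto
  moreover have "\<alpha> = 0"
  proof -
    have "\<alpha> < 2"
    proof (rule ccontr)
      assume "\<not> ?thesis"
      then have "(r + 1) * 2 \<le> (r + 1) * \<alpha>" by (intro mult_left_mono) auto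
      then show False using i r \<open>a = 0\<close> by simp
    qed
    moreover have "\<alpha> \<noteq> 1"
    proof
      assume "\<alpha> = 1"
      then have "3 * \<beta> + 2 * \<gamma> = 1" using i \<open>a = 0\<close> by simp
      then show False by presburger
    qed
    ultimately show ?thesis by simp
  qed
  ultimately have i': "r + 2 = 3 * \<beta> + 2 * \<gamma>" using i by simp
  have "(2 * r + 1) * (m + 2) = (r + 2) + (3 * r + (2 * r + 1) * m)" by (simp add: algebra_simps)
  also have "\<dots> = (2 * r + 1) * (\<beta> + \<gamma> + \<delta>)"
    unfolding j by (subst i') (simp add: \<open>\<alpha> = 0\<close> q algebra_simps)
  finally have "m + 2 = \<beta> + \<gamma> + \<delta>" by (simp only: mult_cancel1) simp
  then show "r < 3 * m + 5" using i' by linarith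
qed

section \<open>Polynomials with prescribed exponents\<close>

definition monomial_span :: "(nat \<times> nat) set \<Rightarrow> 'a::field poly poly set" where
  "monomial_span T = {p. \<forall>i j. coeff (coeff p i) j \<noteq> 0 \<longrightarrow> (i, j) \<in> T}"

lemma monomial_spanD: "p \<in> monomial_span T \<Longrightarrow> coeff (coeff p i) j \<noteq> 0 \<Longrightarrow> (i, j) \<in> T"
  unfolding monomial_span_def by blast

lemma monomial_span_mono: "T \<subseteq> T' \<Longrightarrow> monomial_span T \<subseteq> monomial_span T'"
  unfolding monomial_span_def by blast

lemma monomial_span_0: "0 \<in> monomial_span T"
  and monomial_span_uminus: "p \<in> monomial_span T \<Longrightarrow> - p \<in> monomial_span T"
  unfolding monomial_span_def by auto

lemma monomial_span_add:
  assumes "p \<in> monomial_span T" "q \<in> monomial_span T"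
  shows "p + q \<in> monomial_span T"
  using assms unfolding monomial_span_def by (auto, metis add.right_neutral)

lemma monomial_span_mult:
  assumes p: "p \<in> monomial_span T" and q: "q \<in> monomial_span U"
    and TU: "\<And>i j i' j'. (i, j) \<in> T \<Longrightarrow> (i', j') \<in> U \<Longrightarrow> (i + i', j + j') \<in> V"
  shows "p * q \<in> monomial_span V"
  unfolding monomial_span_def
proof (intro CollectI allI impI)
  fix m n assume "coeff (coeff (p * q) m) n \<noteq> 0"
  then have "(\<Sum>i\<le>m. \<Sum>j\<le>n. coeff (coeff p i) j * coeff (coeff q (m - i)) (n - j)) \<noteq> 0"
    by (simp add: coeff_mult coeff_sum)
  then obtain i where i: "i \<le> m" "(\<Sum>j\<le>n. coeff (coeff p i) j * coeff (coeff q (m - i)) (n - j)) \<noteq> 0"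
    by (auto elim: sum.not_neutral_contains_not_neutral)
  then obtain j where j: "j \<le> n" "coeff (coeff p i) j * coeff (coeff q (m - i)) (n - j) \<noteq> 0"
    by (auto elim: sum.not_neutral_contains_not_neutral)
  then have "(i + (m - i), j + (n - j)) \<in> V"
    using p q by (intro TU) (auto dest: monomial_spanD)
  then show "(m, n) \<in> V" using i(1) j(1) by simp
qed

abbreviation bimonom :: "'a::field \<Rightarrow> nat \<Rightarrow> nat \<Rightarrow> 'a poly poly" where
  "bimonom c i j \<equiv> monom (monom c j) i"

lemma bimonom_in_monomial_span_iff: "bimonom c i j \<in> monomial_span T \<longleftrightarrow> c = 0 \<or> (i, j) \<in> T"
  unfolding monomial_span_def by auto

lemma var_s_eq: "var_s = bimonom 1 1 0"
  by (simp add: var_s_def monom_0 monom_Suc one_pCons)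

lemma var_t_eq: "var_t = bimonom 1 0 1"
  by (simp add: var_t_def monom_0 monom_Suc)

lemma bimonom_power: "bimonom c i j ^ n = bimonom (c ^ n) (i * n) (j * n)"
  by (simp only: monom_power)

lemma var_s_power: "var_s ^ n = bimonom 1 n 0" and var_t_power: "var_t ^ n = bimonom 1 0 n"
  unfolding var_s_eq var_t_eq bimonom_power by simp_all

lemma curve_monomials_eq:
  "curve_monomials r =
     {bimonom 1 (2 * r + 1) 0, bimonom 1 (r + 1) r, bimonom 1 3 (2 * r - 2),
      bimonom 1 2 (2 * r - 1), bimonom 1 0 (2 * r + 1)}"
  unfolding curve_monomials_def var_s_power var_t_power by (simp only: mult_monom) simp

abbreviation curve_algebra :: "nat \<Rightarrow> 'a::field poly poly set" where
  "curve_algebra r \<equiv> monomial_span (curve_exponents r)"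

lemma a_inv_ring_of_type_algebra [simp]:
  "\<ominus>\<^bsub>ring_of_type_algebra\<^esub> x = - (x :: 'c::comm_ring_1)"
proof -
  interpret ring "ring_of_type_algebra :: 'c ring" by (rule ring_from_type_algebra)
  show ?thesis by (rule minus_equality) (auto simp: ring_of_type_algebra_def)
qed

definition generator_exponents :: "nat \<Rightarrow> (nat \<times> nat) set" where
  "generator_exponents r =
     {(2 * r + 1, 0), (r + 1, r), (3, 2 * r - 2), (2, 2 * r - 1), (0, 2 * r + 1)}"

lemma curve_monomials_in_span: "curve_monomials r \<subseteq> monomial_span (generator_exponents r)"
  unfolding curve_monomials_eq generator_exponents_def
  by (simp only: insert_subset empty_subsetI bimonom_in_monomial_span_iff) simp

lemma generator_exponents_subset: "generator_exponents r \<subseteq> curve_exponents r"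
proof -
  have "(r + 1, r) \<in> curve_exponents r" by (rule curve_exponentsI[of _ _ 0 1 0 0 _ 0]) auto
  moreover have "(3, 2 * r - 2) \<in> curve_exponents r" by (rule curve_exponentsI[of _ _ 0 0 1 0 _ 0]) auto
  moreover have "(2, 2 * r - 1) \<in> curve_exponents r" by (rule curve_exponentsI[of _ _ 0 0 0 1 _ 0]) auto
  ultimately show ?thesis
    using curve_exponents_s[of r 1] curve_exponents_t[of r 1]
    by (simp add: generator_exponents_def)
qed

text \<open>
  A product of generators is a monomial whose exponents lie in \<open>curve_exponents r\<close>, and every such
  monomial is one, so membership in the algebra can be read off the exponents of a polynomial.
\<close>
lemma generate_ring_curve:
  "generate_ring ring_of_type_algebra (range (\<lambda>c. [:[:c:]:]) \<union> curve_monomials r) =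
     (curve_algebra r :: 'a::field poly poly set)"
  (is "?G = _")
proof
  have mult: "x * y \<in> ?G" and add: "x + y \<in> ?G" if "x \<in> ?G" "y \<in> ?G" for x y
    using generate_ring.eng_mult[OF that] generate_ring.eng_add[OF that]
    by (auto simp: ring_of_type_algebra_def)
  show "curve_algebra r \<subseteq> ?G"
  proof
    fix p :: "'a poly poly" assume p: "p \<in> curve_algebra r"
    have const: "bimonom c 0 0 \<in> ?G" for c :: 'a
      by (rule generate_ring.incl) (simp add: monom_0)
    have zero: "0 \<in> ?G" using const[of 0] by simp
    have sum: "(\<Sum>x\<in>A. f x) \<in> ?G" if "\<And>x. x \<in> A \<Longrightarrow> f x \<in> ?G" for A :: "nat set" and f
      using that by (induction A rule: infinite_finite_induct) (auto intro: zero add)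
    have power: "bimonom 1 (n * i) (n * j) \<in> ?G" if "bimonom (1 :: 'a) i j \<in> curve_monomials r" for i j n
    proof (induction n)
      case 0 then show ?case using const[of 1] by simp
    next
      case (Suc n)
      have "bimonom (1 :: 'a) i j \<in> ?G" using that by (intro generate_ring.incl) simp
      from mult[OF this Suc] show ?case by (simp add: mult_monom)
    qed
    have mono: "bimonom c i j \<in> ?G" if ij: "(i, j) \<in> curve_exponents r" for c :: 'a and i j
    proof -
      obtain a \<alpha> \<beta> \<gamma> \<delta> where
        "i = (2 * r + 1) * a + (r + 1) * \<alpha> + 3 * \<beta> + 2 * \<gamma>"
        "j = r * \<alpha> + (2 * r - 2) * \<beta> + (2 * r - 1) * \<gamma> + (2 * r + 1) * \<delta>"
        using ij by (rule curve_exponentsE)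
      then have "bimonom c i j = bimonom c 0 0 * (bimonom 1 (a * (2 * r + 1)) (a * 0) *
          (bimonom 1 (\<alpha> * (r + 1)) (\<alpha> * r) * (bimonom 1 (\<beta> * 3) (\<beta> * (2 * r - 2)) *
          (bimonom 1 (\<gamma> * 2) (\<gamma> * (2 * r - 1)) * bimonom 1 (\<delta> * 0) (\<delta> * (2 * r + 1))))))"
        by (simp only: mult_monom) (simp add: ac_simps)
      also have "\<dots> \<in> ?G"
        by (intro mult const power) (simp_all add: curve_monomials_eq)
      finally show ?thesis .
    qed
    have "p = (\<Sum>i\<le>degree p. \<Sum>j\<le>degree (coeff p i). bimonom (coeff (coeff p i) j) i j)"
      by (simp flip: monom_sum add: poly_as_sum_of_monoms)
    also have "\<dots> \<in> ?G"
    proof (intro sum)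
      fix i j
      show "bimonom (coeff (coeff p i) j) i j \<in> ?G"
        using mono monomial_spanD[OF p] zero by (cases "coeff (coeff p i) j = 0") auto
    qed
    finally show "p \<in> ?G" .
  qed
  show "?G \<subseteq> curve_algebra r"
  proof
    fix p assume "p \<in> ?G"
    then show "p \<in> curve_algebra r"
    proof induction
      case one
      show ?case
        using bimonom_in_monomial_span_iff[of "1 :: 'a" 0 0] curve_exponents_0
        by (simp add: ring_of_type_algebra_def)
    next
      case (incl h)
      have "curve_monomials r \<subseteq> (curve_algebra r :: 'a poly poly set)"
        using curve_monomials_in_span monomial_span_mono[OF generator_exponents_subset] by blast
      moreover have "[:[:c:]:] \<in> curve_algebra r" for c :: 'a
        using bimonom_in_monomial_span_iff[of c 0 0] curve_exponents_0 by (simp add: monom_0)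
      ultimately show ?case using incl by blast
    next
      case (a_inv h) then show ?case by (simp add: monomial_span_uminus)
    next
      case (eng_add h1 h2) then show ?case by (simp add: ring_of_type_algebra_def monomial_span_add)
    next
      case (eng_mult h1 h2)
      then show ?case
        using monomial_span_mult[OF eng_mult.IH curve_exponents_add] by (simp add: ring_of_type_algebra_def)
    qed
  qed
qed

lemma curve_ring_eq: "curve_ring r = subring_of_type (curve_algebra r)"
  unfolding curve_ring_def subring_of_type_def generate_ring_curve ..

lemma curve_ring_ring: "ring (curve_ring r :: 'a::field poly poly ring)"
  unfolding curve_ring_def
  by (rule ring.generate_ring_is_ring[OF ring_from_type_algebra]) (simp add: ring_of_type_algebra_def)

lemma monomial_span_ideal:
  assumes "T \<subseteq> curve_exponents r"
    and T: "\<And>i j i' j'. (i, j) \<in> curve_exponents r \<Longrightarrow> (i', j') \<in> T \<Longrightarrow> (i + i', j + j') \<in> T"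
  shows "ideal (monomial_span T) (curve_ring r :: 'a::field poly poly ring)"
proof -
  interpret ring "curve_ring r :: 'a poly poly ring" by (rule curve_ring_ring)
  have sub: "monomial_span T \<subseteq> (curve_algebra r :: 'a poly poly set)"
    by (rule monomial_span_mono) fact
  have neg: "\<ominus>\<^bsub>curve_ring r\<^esub> p = - p" if "p \<in> curve_algebra r" for p :: "'a poly poly"
    using that monomial_span_uminus by (intro minus_equality) (auto simp: curve_ring_eq)
  show ?thesis
  proof (rule idealI)
    show "subgroup (monomial_span T) (add_monoid (curve_ring r :: 'a poly poly ring))"
    proof (rule add.subgroupI)
      show "monomial_span T \<subseteq> carrier (curve_ring r :: 'a poly poly ring)"
        using sub by (simp add: curve_ring_eq)
      show "monomial_span T \<noteq> ({} :: 'a poly poly set)" using monomial_span_0 by blast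
    next
      fix p :: "'a poly poly" assume p: "p \<in> monomial_span T"
      show "\<ominus>\<^bsub>curve_ring r\<^esub> p \<in> monomial_span T"
        using neg[of p] sub p monomial_span_uminus[OF p] by auto
      fix q :: "'a poly poly" assume q: "q \<in> monomial_span T"
      show "p \<oplus>\<^bsub>curve_ring r\<^esub> q \<in> monomial_span T"
        using monomial_span_add[OF p q] by (simp add: curve_ring_eq)
    qed
    fix p x :: "'a poly poly"
    assume "p \<in> monomial_span T" "x \<in> carrier (curve_ring r)"
    then show "x \<otimes>\<^bsub>curve_ring r\<^esub> p \<in> monomial_span T" "p \<otimes>\<^bsub>curve_ring r\<^esub> x \<in> monomial_span T"
      using monomial_span_mult[of x "curve_exponents r" p T T, OF _ _ T]
      by (simp_all add: curve_ring_eq mult.commute)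
  qed (rule curve_ring_ring)
qed

lemma curve_max_ideal_ideal: "ideal (curve_max_ideal r) (curve_ring r :: 'a::field poly poly ring)"
  and curve_monomials_in_max_ideal: "(curve_monomials r :: 'a poly poly set) \<subseteq> curve_max_ideal r"
proof -
  interpret ring "curve_ring r :: 'a poly poly ring" by (rule curve_ring_ring)
  have "curve_monomials r \<subseteq> carrier (curve_ring r :: 'a poly poly ring)"
    using curve_monomials_in_span monomial_span_mono[OF generator_exponents_subset]
    by (auto simp: curve_ring_eq)
  then show "ideal (curve_max_ideal r) (curve_ring r :: 'a poly poly ring)"
    "(curve_monomials r :: 'a poly poly set) \<subseteq> curve_max_ideal r"
    unfolding curve_max_ideal_def by (rule genideal_ideal, rule genideal_self)
qed

section \<open>Powers of the maximal ideal\<close>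

text \<open>
  A superset of the exponents that occur in the \<open>k\<close>-th power of the maximal ideal. It records only
  what that power does on the \<open>t\<close>-axis, because all other multipliers fill the gaps at once.
\<close>
definition power_exponents :: "nat \<Rightarrow> nat \<Rightarrow> (nat \<times> nat) set" where
  "power_exponents r k = {(i, j) \<in> curve_exponents r. i = 0 \<longrightarrow> (2 * r + 1) * k \<le> j}"

lemma ideal_power_curve_max_ideal:
  "ideal_power (curve_ring r) (curve_max_ideal r) k \<subseteq>
     (monomial_span (power_exponents r k) :: 'a::field poly poly set)"
proof (induction k)
  case 0
  then show ?case by (simp add: ideal_power_0 curve_ring_eq power_exponents_def)
next
  case (Suc k)
  interpret ring "curve_ring r :: 'a poly poly ring" by (rule curve_ring_ring)
  have max: "curve_max_ideal r \<subseteq> (monomial_span (power_exponents r 1) :: 'a poly poly set)"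
    unfolding curve_max_ideal_def
  proof (rule genideal_minimal)
    show "ideal (monomial_span (power_exponents r 1)) (curve_ring r :: 'a poly poly ring)"
      by (rule monomial_span_ideal) (auto simp: power_exponents_def curve_exponents_add)
    have "generator_exponents r \<subseteq> power_exponents r 1"
      using generator_exponents_subset[of r]
      by (auto simp: power_exponents_def generator_exponents_def)
    then show "(curve_monomials r :: 'a poly poly set) \<subseteq> monomial_span (power_exponents r 1)"
      using curve_monomials_in_span monomial_span_mono by blast
  qed
  show ?case
  proof
    fix p assume "p \<in> ideal_power (curve_ring r) (curve_max_ideal r :: 'a poly poly set) (Suc k)"
    then have "p \<in> ideal_prod (curve_ring r) (ideal_power (curve_ring r) (curve_max_ideal r) k)
        (curve_max_ideal r)"
      by (simp add: ideal_power_Suc)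
    then show "p \<in> monomial_span (power_exponents r (Suc k))"
    proof induction
      case (prod x y)
      then have "x * y \<in> monomial_span (power_exponents r (Suc k))"
        using Suc max
        by (intro monomial_span_mult[of x "power_exponents r k" y "power_exponents r 1"])
          (auto simp: power_exponents_def curve_exponents_add)
      then show ?case by (simp add: curve_ring_eq)
    next
      case (sum x y)
      then show ?case by (simp add: curve_ring_eq monomial_span_add)
    qed
  qed
qed

text \<open>
  A multiplier on the \<open>t\<close>-axis moves a gap up by at least \<open>k\<close> places in its column, past the top of the
  column. Any other multiplier stays within the saturation but leaves the column \<open>r + 2\<close>, to which
  all gaps belong.
\<close>
lemma power_exponents_fill_gaps:
  assumes r: "r \<ge> 5" and k: "r < 3 * k + 5" and ij: "(i, j) \<in> power_exponents r k"
  shows "(i + (r + 2), j + (3 * r + (2 * r + 1) * m)) \<in> curve_exponents r"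
proof (cases "i = 0")
  case True
  have S: "(0, j) \<in> curve_exponents r" and j: "(2 * r + 1) * k \<le> j"
    using ij True unfolding power_exponents_def by auto
  obtain l where l: "j = (2 * r + 1) * l"
    using curve_exponents_degree[OF S] r by auto
  then have "k \<le> l" using j by (simp only: mult_le_cancel1)
  then have "(r + 2, 3 * r + (2 * r + 1) * (l + m)) \<in> curve_exponents r"
    using k gap_in_exponents_iff[OF r] by simp
  then show ?thesis by (simp add: True l algebra_simps)
next
  case False
  have S: "(i, j) \<in> curve_exponents r" using ij unfolding power_exponents_def by auto
  have "((2 * r + 1) * r + (r + 2), 3 * r + (2 * r + 1) * m) \<in> curve_exponents r"
    using r by (intro curve_exponentsI[of _ _ "r - 1" 3 0 0 _ m]) (cases r, auto simp: algebra_simps)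
  from curve_exponents_add[OF S this]
  have s: "((2 * r + 1) * r + (i + (r + 2)), j + (3 * r + (2 * r + 1) * m)) \<in> curve_exponents r"
    by (simp add: ac_simps)
  have "(r + 2, 3 * r + (2 * r + 1) * (r + m)) \<in> curve_exponents r"
    using gap_in_exponents_iff[OF r, of "r + m"] by simp
  from curve_exponents_add[OF S this]
  have t: "(i + (r + 2), (2 * r + 1) * r + (j + (3 * r + (2 * r + 1) * m))) \<in> curve_exponents r"
    by (simp add: algebra_simps)
  show ?thesis using saturation_gaps[OF r s t] False by auto
qed

text \<open>
  The monomial \<open>s\<^bsup>r+2\<^esup>t\<^bsup>3r\<^esup>\<close> at the bottom of the column of gaps shows that no smaller power
  suffices: \<open>t\<^bsup>(2r+1)k\<^esup>\<close> carries it to another gap as long as \<open>3 k + 5 \<le> r\<close>.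
\<close>
theorem power_annihilates_local_cohomology_iff:
  fixes e :: "'a::field poly poly \<Rightarrow> 'b"
  assumes r: "r \<ge> 5"
    and res: "injective_resolution (curve_ring r) (regular_module (curve_ring r)) e I d"
  shows "annihilates (ideal_power (curve_ring r) (curve_max_ideal r) k)
           (local_cohomology (curve_ring r) (curve_max_ideal r) I d 1) \<longleftrightarrow> r < 3 * k + 5"
proof -
  let ?R = "curve_ring r :: 'a poly poly ring" and ?J = "curve_max_ideal r :: 'a poly poly set"
  let ?C = "curve_algebra r :: 'a poly poly set"
  let ?P = "ideal_power ?R ?J"
  define D where "D = 2 * r + 1"
  define a b :: "'a poly poly" where "a = bimonom 1 D 0" and "b = bimonom 1 0 D"
  have a_pow: "a ^ n = bimonom 1 (D * n) 0" and b_pow: "b ^ n = bimonom 1 0 (D * n)" for n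
    by (simp_all add: a_def b_def monom_power)
  have ab: "a \<in> ?J" "b \<in> ?J"
    using curve_monomials_in_max_ideal[of r] unfolding curve_monomials_eq a_def b_def D_def by blast+
  have power: "c ^ n \<in> ?P n" if "c \<in> ?J" for c n
    using power_in_ideal_power[OF _ _ that] curve_ring_ring curve_max_ideal_ideal
    unfolding curve_ring_eq by metis
  have "annihilates (?P k) (local_cohomology ?R ?J I d 1) \<longleftrightarrow>
      (\<forall>z. (\<exists>n. \<forall>p\<in>?P n. p * z \<in> ?C) \<longrightarrow> (\<forall>w\<in>?P k. w * z \<in> ?C))"
    unfolding curve_ring_eq
  proof (rule annihilates_local_cohomology_1_iff)
    show "injective_resolution (subring_of_type ?C) (regular_module (subring_of_type ?C)) e I d"
      "ideal ?J (subring_of_type ?C)"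
      using res curve_max_ideal_ideal[of r] unfolding curve_ring_eq by auto
    show "a \<noteq> 0" by (simp add: a_def)
    \<comment> \<open>The multiplier \<open>b\<^sup>n\<close> leaves exponents of \<open>s\<close> unchanged, so the divisibility by \<open>a\<^sup>n\<close> is due to \<open>f\<close>.\<close>
    show "a ^ n dvd f" if "b ^ n * f = a ^ n * g" for n f g
    proof -
      have "coeff f k = 0" if "k < D * n" for k
      proof -
        have "coeff (b ^ n * f) k = 0"
          using \<open>k < D * n\<close> unfolding \<open>b ^ n * f = a ^ n * g\<close> a_pow by (simp add: coeff_monom_mult)
        then show ?thesis unfolding b_pow by (simp add: coeff_monom_mult)
      qed
      then have "monom 1 (D * n) dvd f" by (simp add: monom_1_dvd_iff')
      then show ?thesis unfolding a_pow by (simp add: one_pCons monom_0)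
    qed
    show "ideal_power (subring_of_type ?C) ?J k \<subseteq> ?C"
      using ideal.Icarr[OF ring.ideal_power_ideal[OF curve_ring_ring curve_max_ideal_ideal]]
      by (auto simp: curve_ring_eq)
  qed (use ab in auto)
  also have "\<dots> \<longleftrightarrow> r < 3 * k + 5"
  proof (intro iffI allI impI ballI)
    fix z w assume k: "r < 3 * k + 5" and "\<exists>n. \<forall>p\<in>?P n. p * z \<in> ?C" and w: "w \<in> ?P k"
    then obtain n where n: "\<And>p. p \<in> ?P n \<Longrightarrow> p * z \<in> ?C" by blast
    let ?G = "{(i, j). \<exists>m. i = r + 2 \<and> j = 3 * r + D * m}"
    have "z \<in> monomial_span (curve_exponents r \<union> ?G)"
      unfolding monomial_span_def
    proof (intro CollectI allI impI)
      fix i j assume ij: "coeff (coeff z i) j \<noteq> 0"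
      have "(D * n + i, j) \<in> curve_exponents r"
        using monomial_spanD[OF n[OF power[OF ab(1)]], of "D * n + i" j] ij
        by (simp add: a_pow coeff_monom_mult)
      moreover have "(i, D * n + j) \<in> curve_exponents r"
        using monomial_spanD[OF n[OF power[OF ab(2)]], of i "D * n + j"] ij
        by (simp add: b_pow coeff_monom_mult)
      ultimately show "(i, j) \<in> curve_exponents r \<union> ?G"
        using saturation_gaps[OF r, of n i j] unfolding D_def by blast
    qed
    moreover have "w \<in> monomial_span (power_exponents r k)"
      using w ideal_power_curve_max_ideal by blast
    ultimately show "w * z \<in> ?C"
    proof (intro monomial_span_mult)
      fix i j i' j' assume "(i, j) \<in> power_exponents r k" "(i', j') \<in> curve_exponents r \<union> ?G"
      then show "(i + i', j + j') \<in> curve_exponents r"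
        using power_exponents_fill_gaps[OF r k] curve_exponents_add
        by (auto simp: D_def power_exponents_def)
    qed
  next
    assume all: "\<forall>z. (\<exists>n. \<forall>p\<in>?P n. p * z \<in> ?C) \<longrightarrow> (\<forall>w\<in>?P k. w * z \<in> ?C)"
    let ?z = "bimonom 1 (r + 2) (3 * r) :: 'a poly poly"
    \<comment> \<open>The exponent \<open>r\<close> is one that satisfies \<open>r < 3 r + 5\<close>, so \<open>?P r\<close> carries \<open>?z\<close> into the algebra.\<close>
    have "p * ?z \<in> ?C" if "p \<in> ?P r" for p
    proof (rule monomial_span_mult)
      show "p \<in> monomial_span (power_exponents r r)" using that ideal_power_curve_max_ideal by blast
      show "?z \<in> monomial_span {(r + 2, 3 * r)}" by (simp add: bimonom_in_monomial_span_iff)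
      show "(i + i', j + j') \<in> curve_exponents r"
        if "(i, j) \<in> power_exponents r r" "(i', j') \<in> {(r + 2, 3 * r)}" for i j i' j'
        using power_exponents_fill_gaps[OF r _ that(1), of 0] that(2) by simp
    qed
    then have "b ^ k * ?z \<in> ?C" using all power[OF ab(2)] by blast
    then have "(r + 2, 3 * r + D * k) \<in> curve_exponents r"
      by (simp add: b_pow mult_monom bimonom_in_monomial_span_iff add.commute)
    then show "r < 3 * k + 5" using gap_in_exponents_iff[OF r] unfolding D_def by blast
  qed
  finally show ?thesis .
qed

theorem theorem1p3:
  fixes r k :: nat
    and e :: "'a::field poly poly \<Rightarrow> 'b"
    and I :: "nat \<Rightarrow> ('a poly poly, 'b) module"
    and d :: "nat \<Rightarrow> 'b \<Rightarrow> 'b"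
  assumes "r \<ge> 5" and "k \<ge> 1"
    and "injective_resolution (curve_ring r) (regular_module (curve_ring r)) e I d"
  shows "strictly_k_Buchsbaum (curve_ring r) (curve_max_ideal r) I d k \<longleftrightarrow>
         r \<in> {2 + 3 * k, 3 + 3 * k, 4 + 3 * k}"
  using \<open>k \<ge> 1\<close>
  unfolding strictly_k_Buchsbaum_def k_Buchsbaum_def insert_iff empty_iff
    power_annihilates_local_cohomology_iff[OF assms(1,3)]
  by presburger

end
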